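(* There are infinitely many (pairwise non-isomorphic) $6$-edge-connected graphs with no spanning bipartite 2T-subgraph.
   Context: Graphs are finite, undirected, without loops or multiple edges. A graph $G$ is $k$-edge-connected if every non-empty proper subset $X\subset V(G)$ has at least $k$ edges with exactly one end-vertex in $X$. A 2T-graph is a graph whose edge set decomposes into (the edge sets of) two edge-disjoint spanning trees. A spanning bipartite 2T-subgraph of $G$ is a bipartite subgraph $H$ with $V(H)=V(G)$ that is a 2T-graph. *)

theory Defs
  imports Main
begin

record 'a ugraph =
  uverts :: "'a set"
  uedges :: "'a set set"

text \<open>
  An edge is the two-element set of its end-vertices, so loops and multiple edges are excluded.
\<close>

definition simple_graph :: "'a ugraph \<Rightarrow> bool" where
  "simple_graph G \<longleftrightarrow>
     finite (uverts G) \<and> (\<forall>e\<in>uedges G. e \<subseteq> uverts G \<and> card e = 2)"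

definition graph_iso :: "'a ugraph \<Rightarrow> 'b ugraph \<Rightarrow> bool" where
  "graph_iso G H \<longleftrightarrow>
     (\<exists>f. bij_betw f (uverts G) (uverts H) \<and> (\<lambda>e. f ` e) ` uedges G = uedges H)"

definition k_edge_connected :: "nat \<Rightarrow> 'a ugraph \<Rightarrow> bool" where
  "k_edge_connected k G \<longleftrightarrow>
     (\<forall>X. X \<noteq> {} \<and> X \<subset> uverts G \<longrightarrow> k \<le> card {e \<in> uedges G. card (e \<inter> X) = 1})"

definition spanning_subgraph :: "'a ugraph \<Rightarrow> 'a ugraph \<Rightarrow> bool" where
  "spanning_subgraph H G \<longleftrightarrow>
     simple_graph H \<and> uverts H = uverts G \<and> uedges H \<subseteq> uedges G"

definition connected_graph :: "'a ugraph \<Rightarrow> bool" where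
  "connected_graph G \<longleftrightarrow>
     uverts G \<noteq> {} \<and>
     (\<forall>u\<in>uverts G. \<forall>v\<in>uverts G. (u, v) \<in> {(x, y). {x, y} \<in> uedges G}\<^sup>*)"

text \<open>A cycle is given by the list of its vertices, in order, without repeating the first one.\<close>

definition graph_cycle :: "'a ugraph \<Rightarrow> 'a list \<Rightarrow> bool" where
  "graph_cycle G c \<longleftrightarrow>
     3 \<le> length c \<and> distinct c \<and>
     (\<forall>i<length c. {c ! i, c ! (Suc i mod length c)} \<in> uedges G)"

definition tree_graph :: "'a ugraph \<Rightarrow> bool" where
  "tree_graph T \<longleftrightarrow> simple_graph T \<and> connected_graph T \<and> (\<nexists>c. graph_cycle T c)"

definition spanning_tree_of :: "'a ugraph \<Rightarrow> 'a ugraph \<Rightarrow> bool" where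
  "spanning_tree_of T G \<longleftrightarrow> tree_graph T \<and> spanning_subgraph T G"

definition two_T_graph :: "'a ugraph \<Rightarrow> bool" where
  "two_T_graph G \<longleftrightarrow>
     simple_graph G \<and>
     (\<exists>T1 T2. spanning_tree_of T1 G \<and> spanning_tree_of T2 G \<and>
        uedges T1 \<inter> uedges T2 = {} \<and> uedges T1 \<union> uedges T2 = uedges G)"

definition bipartite_graph :: "'a ugraph \<Rightarrow> bool" where
  "bipartite_graph G \<longleftrightarrow>
     (\<exists>A B. A \<union> B = uverts G \<and> A \<inter> B = {} \<and>
        (\<forall>e\<in>uedges G. \<exists>a\<in>A. \<exists>b\<in>B. e = {a, b}))"

definition spanning_bipartite_2T_subgraph :: "'a ugraph \<Rightarrow> 'a ugraph \<Rightarrow> bool" where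
  "spanning_bipartite_2T_subgraph H G \<longleftrightarrow>
     spanning_subgraph H G \<and> bipartite_graph H \<and> two_T_graph H"

end

theory Submission
  imports Defs
begin

text \<open>
  Take \<open>3m\<close> disjoint copies of \<open>K\<^sub>5\<close> (the rows) and cover their vertices by \<open>5m\<close> disjoint triangles,
  so that every edge lies in exactly one of these cliques. A cut contains at most \<open>6\<close> edges of
  a \<open>K\<^sub>5\<close> and at most \<open>2\<close> edges of a triangle, hence at most \<open>6 \<cdot> 3m + 2 \<cdot> 5m = 28m\<close> edges, whereas
  two edge-disjoint spanning trees need \<open>2(15m - 1) = 30m - 2\<close>. For \<open>m \<ge> 2\<close> no bipartite subgraph
  can contain them.

  The triangles consist of three cyclically consecutive rows in a common column, with a phase
  that depends on the column. A cut splitting a row contains at least \<open>4\<close> of its edges, and the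
  phases force a second clique to be split, which gives at least \<open>2\<close> more. A cut splitting
  no row separates two consecutive rows, and these share a triangle in at least three of
  the five columns.
\<close>

section \<open>Connected graphs\<close>

lemma rtrancl_leaves_set:
  assumes "(u, v) \<in> R\<^sup>*" "u \<in> S" "v \<notin> S"
  shows "\<exists>x y. (x, y) \<in> R \<and> x \<in> S \<and> y \<notin> S"
  using assms by (induction rule: rtrancl_induct) blast+

text \<open>Grow a vertex set from a single vertex. While it is not everything, some walk leaves it,
  and the edge by which the walk leaves adds one vertex and at least one new spanned edge.\<close>

lemma connected_graph_card_edges:
  assumes G: "simple_graph G" and C: "connected_graph G"
  shows "card (uverts G) \<le> card (uedges G) + 1"
proof -
  let ?V = "uverts G" and ?E = "uedges G"
  have finV: "finite ?V" and edge: "\<And>e. e \<in> ?E \<Longrightarrow> e \<subseteq> ?V \<and> card e = 2"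
    using G by (auto simp: simple_graph_def)
  have finE: "finite ?E"
    by (rule finite_subset[of _ "Pow ?V"]) (use edge finV in auto)
  have "\<exists>S\<subseteq>?V. card S = Suc j \<and> j \<le> card {e \<in> ?E. e \<subseteq> S}" if "Suc j \<le> card ?V" for j
    using that
  proof (induction j)
    case 0
    obtain r where "r \<in> ?V" using C by (auto simp: connected_graph_def)
    then show ?case by (intro exI[of _ "{r}"]) auto
  next
    case (Suc j)
    then obtain S where S: "S \<subseteq> ?V" "card S = Suc j" "j \<le> card {e \<in> ?E. e \<subseteq> S}"
      by auto
    have finS: "finite S" using S(1) finV by (rule finite_subset)
    obtain u where u: "u \<in> S" using S(2) by fastforce
    have "\<not> ?V \<subseteq> S" using card_mono[OF finS, of ?V] S(2) Suc.prems by auto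
    then obtain v where v: "v \<in> ?V" "v \<notin> S" by blast
    have "(u, v) \<in> {(x, y). {x, y} \<in> ?E}\<^sup>*"
      using C u v S(1) by (auto simp: connected_graph_def)
    from rtrancl_leaves_set[OF this u v(2)]
    obtain x y where xy: "{x, y} \<in> ?E" "x \<in> S" "y \<notin> S" by auto
    have "insert {x, y} {e \<in> ?E. e \<subseteq> S} \<subseteq> {e \<in> ?E. e \<subseteq> insert y S}" using xy by auto
    then have "card (insert {x, y} {e \<in> ?E. e \<subseteq> S}) \<le> card {e \<in> ?E. e \<subseteq> insert y S}"
      by (intro card_mono) (use finE in auto)
    moreover have "card (insert {x, y} {e \<in> ?E. e \<subseteq> S}) = Suc (card {e \<in> ?E. e \<subseteq> S})"
      by (intro card_insert_disjoint) (use finE xy in auto)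
    ultimately show ?case
      using S finS xy edge[OF xy(1)] by (intro exI[of _ "insert y S"]) auto
  qed
  moreover have "0 < card ?V" using C finV by (simp add: connected_graph_def card_gt_0_iff)
  ultimately obtain S where "card ?V - 1 \<le> card {e \<in> ?E. e \<subseteq> S}"
    by (metis Suc_pred' order_refl)
  also have "card {e \<in> ?E. e \<subseteq> S} \<le> card ?E" by (intro card_mono) (use finE in auto)
  finally show ?thesis by simp
qed

lemma two_T_graph_card_edges:
  assumes "two_T_graph G"
  shows "2 * card (uverts G) \<le> card (uedges G) + 2"
proof -
  from assms obtain T1 T2 where G: "simple_graph G"
    and T: "spanning_tree_of T1 G" "spanning_tree_of T2 G"
    and disj: "uedges T1 \<inter> uedges T2 = {}" and un: "uedges T1 \<union> uedges T2 = uedges G"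
    by (auto simp: two_T_graph_def)
  have *: "card (uverts G) \<le> card (uedges T) + 1" if "spanning_tree_of T G" for T
    using that connected_graph_card_edges[of T]
    by (auto simp: spanning_tree_of_def tree_graph_def spanning_subgraph_def)
  have "finite (uedges G)"
    by (rule finite_subset[of _ "Pow (uverts G)"]) (use G in \<open>auto simp: simple_graph_def\<close>)
  then have "card (uedges G) = card (uedges T1) + card (uedges T2)"
    using disj un by (metis card_Un_disjoint finite_Un)
  with *[OF T(1)] *[OF T(2)] show ?thesis by simp
qed

section \<open>Cuts of unions of cliques\<close>

text \<open>The cut of \<open>X\<close> within the complete graph on \<open>B\<close>, encoded as
  the image of a product so that its size is a product.\<close>

definition cross :: "'a set \<Rightarrow> 'a set \<Rightarrow> 'a set set" where
  "cross X B = (\<lambda>(x, y). {x, y}) ` ((B \<inter> X) \<times> (B - X))"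

definition splits :: "'a set \<Rightarrow> 'a set \<Rightarrow> bool" where
  "splits X B \<longleftrightarrow> B \<inter> X \<noteq> {} \<and> B - X \<noteq> {}"

lemma finite_cross [simp]: "finite B \<Longrightarrow> finite (cross X B)"
  by (simp add: cross_def)

lemma card_cross:
  "card (cross X B) = card (B \<inter> X) * card (B - X)"
proof -
  have "inj_on (\<lambda>(x, y). {x, y}) ((B \<inter> X) \<times> (B - X))"
    by (auto simp: inj_on_def doubleton_eq_iff)
  then show ?thesis by (simp add: cross_def card_image card_cartesian_product)
qed

lemma card_Int_Diff_sum: "finite B \<Longrightarrow> card B = card (B \<inter> X) + card (B - X)"
  by (metis Int_Diff_Un Int_Diff_disjoint card_Un_disjoint finite_Diff finite_Int)

text \<open>For positive integers, a product is at least the sum minus one. A split row thus gives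
  at least 4 cut edges, a split triangle at least 2.\<close>

lemma card_cross_ge:
  assumes "finite B" "splits X B"
  shows "card B \<le> card (cross X B) + 1"
proof -
  have "0 < card (B \<inter> X)" "0 < card (B - X)"
    using assms by (auto simp: splits_def card_gt_0_iff)
  then obtain a b where "card (B \<inter> X) = Suc a" "card (B - X) = Suc b"
    by (metis gr0_conv_Suc)
  then show ?thesis using card_Int_Diff_sum[OF assms(1), of X] by (simp add: card_cross)
qed

lemma card_cross_le:
  assumes "finite B"
  shows "4 * card (cross X B) \<le> (card B)\<^sup>2"
proof -
  have "4 * (a * b) \<le> (a + b)\<^sup>2" for a b :: nat
  proof -
    \<comment> \<open>The square of \<open>a - b\<close> is nonnegative; integers are used because
      subtraction on \<open>nat\<close> truncates.\<close>
    have "4 * (int a * int b) \<le> (int a + int b)\<^sup>2"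
      using zero_le_power2[of "int a - int b"] by (simp add: power2_eq_square algebra_simps)
    then show ?thesis by (simp flip: of_nat_mult of_nat_add of_nat_power)
  qed
  then show ?thesis by (simp add: card_cross card_Int_Diff_sum[OF assms, of X])
qed

text \<open>A common edge would have both of its distinct ends in
  \<open>B \<inter> C\<close>.\<close>

lemma cross_disjoint:
  assumes "\<And>x y. x \<in> B \<inter> C \<Longrightarrow> y \<in> B \<inter> C \<Longrightarrow> x = y"
  shows "cross X B \<inter> cross X C = {}"
  using assms by (fastforce simp: cross_def doubleton_eq_iff)

definition clique_union :: "'a set \<Rightarrow> 'a set set \<Rightarrow> 'a ugraph" where
  "clique_union V \<B> =
     \<lparr>uverts = V, uedges = {{x, y} |x y. x \<noteq> y \<and> (\<exists>B\<in>\<B>. x \<in> B \<and> y \<in> B)}\<rparr>"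

lemma simple_graph_clique_union:
  assumes "finite V" "\<And>B. B \<in> \<B> \<Longrightarrow> B \<subseteq> V"
  shows "simple_graph (clique_union V \<B>)"
  using assms by (fastforce simp: simple_graph_def clique_union_def)

lemma cross_subset_cut:
  assumes "B \<in> \<B>"
  shows "cross X B \<subseteq> {e \<in> uedges (clique_union V \<B>). card (e \<inter> X) = 1}"
proof
  fix e assume "e \<in> cross X B"
  then obtain x y where e: "e = {x, y}" "x \<in> B" "x \<in> X" "y \<in> B" "y \<notin> X"
    by (auto simp: cross_def)
  then have "e \<inter> X = {x}" by auto
  then show "e \<in> {e \<in> uedges (clique_union V \<B>). card (e \<inter> X) = 1}"
    using e assms by (auto simp: clique_union_def)
qed

text \<open>The contributions of the split cliques add up because cliques meeting in at most one
  vertex share no edge. This is asked of the subfamily \<open>\<C>\<close> only, so each application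
  checks just the cliques it counts.\<close>

lemma cut_ge_sum_split_cliques:
  assumes V: "finite V" "\<And>B. B \<in> \<B> \<Longrightarrow> B \<subseteq> V"
    and C: "\<C> \<subseteq> \<B>" "finite \<C>" "\<And>B. B \<in> \<C> \<Longrightarrow> splits X B"
    and disj: "\<And>B C x y. \<lbrakk>B \<in> \<C>; C \<in> \<C>; B \<noteq> C; x \<in> B \<inter> C; y \<in> B \<inter> C\<rbrakk> \<Longrightarrow> x = y"
  shows "(\<Sum>B\<in>\<C>. card B - 1) \<le> card {e \<in> uedges (clique_union V \<B>). card (e \<inter> X) = 1}"
proof -
  have fin: "finite B" if "B \<in> \<C>" for B
    using that V C(1) by (meson finite_subset subsetD)
  have finE: "finite (uedges (clique_union V \<B>))"
    by (rule finite_subset[of _ "Pow V"])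
       (use simple_graph_clique_union[of V \<B>] V in \<open>auto simp: simple_graph_def clique_union_def\<close>)
  have "(\<Sum>B\<in>\<C>. card B - 1) \<le> (\<Sum>B\<in>\<C>. card (cross X B))"
    using card_cross_ge[OF fin C(3)] by (intro sum_mono) (simp add: le_diff_conv)
  also have "\<dots> = card (\<Union>B\<in>\<C>. cross X B)"
  proof (intro card_UN_disjoint[symmetric] ballI impI)
    show "cross X B \<inter> cross X C = {}" if "B \<in> \<C>" "C \<in> \<C>" "B \<noteq> C" for B C
      using disj[OF that] by (rule cross_disjoint)
  qed (use C(2) fin in auto)
  also have "\<dots> \<le> card {e \<in> uedges (clique_union V \<B>). card (e \<inter> X) = 1}"
    using C(1) cross_subset_cut[of _ \<B> X V] finE by (intro card_mono) auto
  finally show ?thesis .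
qed

text \<open>One colour class serves as a cut: every edge of \<open>H\<close> lies in some clique and
  crosses that class there. A union bound over the cliques finishes.\<close>

lemma bipartite_subgraph_clique_union_edges:
  assumes B: "finite \<B>" "\<And>B. B \<in> \<B> \<Longrightarrow> finite B"
    and H: "bipartite_graph H" "uedges H \<subseteq> uedges (clique_union V \<B>)"
  shows "card (uedges H) \<le> (\<Sum>B\<in>\<B>. (card B)\<^sup>2 div 4)"
proof -
  obtain P Q where PQ: "P \<inter> Q = {}" "\<And>e. e \<in> uedges H \<Longrightarrow> \<exists>a\<in>P. \<exists>b\<in>Q. e = {a, b}"
    using H(1) unfolding bipartite_graph_def by metis
  have "uedges H \<subseteq> (\<Union>B\<in>\<B>. cross P B)"
  proof
    fix e assume e: "e \<in> uedges H"
    obtain a b where ab: "a \<in> P" "b \<in> Q" "e = {a, b}" using PQ(2)[OF e] by blast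
    obtain B where "B \<in> \<B>" "a \<in> B" "b \<in> B"
      using e H(2) ab by (fastforce simp: clique_union_def doubleton_eq_iff)
    then have "(a, b) \<in> (B \<inter> P) \<times> (B - P)" using ab PQ(1) by blast
    then have "e \<in> cross P B" unfolding cross_def ab(3) by force
    then show "e \<in> (\<Union>B\<in>\<B>. cross P B)" using \<open>B \<in> \<B>\<close> by blast
  qed
  then have "card (uedges H) \<le> card (\<Union>B\<in>\<B>. cross P B)"
    using B by (intro card_mono) auto
  also have "\<dots> \<le> (\<Sum>B\<in>\<B>. card (cross P B))" by (rule card_UN_le[OF B(1)])
  also have "\<dots> \<le> (\<Sum>B\<in>\<B>. (card B)\<^sup>2 div 4)"
    using card_cross_le[OF B(2), of _ P]
    by (intro sum_mono) (simp add: less_eq_div_iff_mult_less_eq mult.commute)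
  finally show ?thesis .
qed

section \<open>The construction\<close>

text \<open>The vertex in row \<open>i < 3m\<close> and column \<open>c < 5\<close> is the number \<open>5i + c\<close>.\<close>

definition row :: "nat \<Rightarrow> nat set" where
  "row i = (\<lambda>c. 5 * i + c) ` {..<5}"

text \<open>The index of the triangle of column \<open>c\<close> that meets row \<open>i\<close>:
  rows are shifted cyclically by \<open>c\<close> and then grouped in threes. Columns in different
  residue classes mod 3 have their triangle boundaries in different places.\<close>

definition phase :: "nat \<Rightarrow> nat \<Rightarrow> nat \<Rightarrow> nat" where
  "phase m c i = (i + c) mod (3 * m) div 3"

definition tri :: "nat \<Rightarrow> nat \<Rightarrow> nat \<Rightarrow> nat set" where
  "tri m c q = (\<lambda>i. 5 * i + c) ` {i. i < 3 * m \<and> phase m c i = q}"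

definition cliques :: "nat \<Rightarrow> nat set set" where
  "cliques m = row ` {..<3 * m} \<union> (\<lambda>(c, q). tri m c q) ` ({..<5} \<times> {..<m})"

definition braid :: "nat \<Rightarrow> nat ugraph" where
  "braid m = clique_union {..<15 * m} (cliques m)"

lemma uverts_braid [simp]: "uverts (braid m) = {..<15 * m}"
  by (simp add: braid_def clique_union_def)

section \<open>Arithmetic of rows, columns and phases\<close>

lemma vertex_eq_iff:
  fixes i j c d :: nat
  assumes "c < 5" "d < 5"
  shows "5 * i + c = 5 * j + d \<longleftrightarrow> i = j \<and> c = d"
  using assms by presburger

lemma vertex_cases:
  fixes v m :: nat
  assumes "v < 15 * m"
  obtains i c where "i < 3 * m" "c < 5" "v = 5 * i + c"
  using that[of "v div 5" "v mod 5"] assms by (simp add: less_mult_imp_div_less)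

lemma mem_row: "c < 5 \<Longrightarrow> 5 * i + c \<in> row i"
  by (auto simp: row_def)

lemma mem_tri_iff:
  assumes "c < 5" "d < 5"
  shows "5 * i + d \<in> tri m c q \<longleftrightarrow> d = c \<and> i < 3 * m \<and> phase m c i = q"
  using vertex_eq_iff[OF assms(2,1)] by (auto simp: tri_def)

lemma card_row [simp]: "card (row i) = 5"
  by (simp add: row_def card_image)

lemma inj_on_shift_mod:
  fixes c k :: nat
  shows "inj_on (\<lambda>i. (i + c) mod k) {..<k}"
proof -
  have *: "i = j" if "i \<le> j" "j < k" "(i + c) mod k = (j + c) mod k" for i j
  proof -
    have "k dvd (j + c) - (i + c)" using that mod_eq_dvd_iff_nat[of "i + c" "j + c" k] by simp
    then have "k dvd j - i" by simp
    then show ?thesis using that by (auto dest: dvd_imp_le)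
  qed
  show ?thesis
    by (rule inj_onI) (metis * lessThan_iff nat_le_linear)
qed

text \<open>The cyclic shift permutes the rows, so each triangle is the preimage of a block of three
  consecutive numbers.\<close>

lemma card_tri:
  assumes "q < m"
  shows "card (tri m c q) = 3"
proof -
  let ?f = "\<lambda>i. (i + c) mod (3 * m)" and ?I = "{i. i < 3 * m \<and> phase m c i = q}"
  have surj: "?f ` {..<3 * m} = {..<3 * m}"
    by (rule endo_inj_surj[OF _ _ inj_on_shift_mod]) (use assms in auto)
  have "?f ` ?I = {j \<in> ?f ` {..<3 * m}. j div 3 = q}"
    by (auto simp: phase_def)
  also have "\<dots> = {j. j < 3 * m \<and> j div 3 = q}" unfolding surj by auto
  also have "\<dots> = {3 * q..<3 * q + 3}" using assms by auto
  finally have "card (?f ` ?I) = 3" by simp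
  moreover have "inj_on ?f ?I"
    by (rule inj_on_subset[OF inj_on_shift_mod]) auto
  ultimately have "card ?I = 3" by (simp add: card_image)
  then show ?thesis by (simp add: tri_def card_image inj_on_def)
qed

lemma clique_subset: "B \<in> cliques m \<Longrightarrow> B \<subseteq> {..<15 * m}"
  by (auto simp: cliques_def row_def tri_def)

lemma row_Int_tri:
  assumes "c < 5" "x \<in> row i \<inter> tri m c q" "y \<in> row i \<inter> tri m c q"
  shows "x = y"
  using assms by (auto simp: row_def mem_tri_iff)

lemma row_Int_row: "i \<noteq> j \<Longrightarrow> row i \<inter> row j = {}"
  by (auto simp: row_def vertex_eq_iff)

lemma tri_Int_tri:
  assumes "c < 5" "d < 5" "c \<noteq> d"
  shows "tri m c q \<inter> tri m d r = {}"
  using vertex_eq_iff[OF assms(1,2)] assms(3) by (auto simp: tri_def)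

text \<open>As 3 divides \<open>3 * m\<close>, reducing mod \<open>3 * m\<close> keeps the residue
  of \<open>i + c\<close> mod 3. If this is not 2, the shifted row is not the last of its block, so
  its successor stays in the block without wrapping around.\<close>

lemma phase_Suc_mod:
  assumes "i < 3 * m" "(i + c) mod 3 \<noteq> 2"
  shows "phase m c (Suc i mod (3 * m)) = phase m c i"
proof -
  let ?k = "3 * m" and ?j = "(i + c) mod (3 * m)"
  have *: "Suc j < 3 * m \<and> Suc j div 3 = j div 3" if "j mod 3 \<noteq> 2" "j < 3 * m" for j
    using that by presburger
  have "?j mod 3 \<noteq> 2" using assms(2) by (simp add: mod_mod_cancel)
  moreover have "?j < ?k" using assms(1) by simp
  ultimately have j: "Suc ?j < ?k" "Suc ?j div 3 = ?j div 3" using * by blast+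
  have "(Suc i mod ?k + c) mod ?k = Suc ?j mod ?k"
    by (simp add: mod_simps)
  then show ?thesis using j by (simp add: phase_def)
qed

text \<open>Row \<open>i\<close> is the middle of its triangle in column \<open>d\<close>, so both
  cyclic neighbours belong to that triangle. The triangle in column \<open>c\<close> contains at
  least one of them: the next row, or the previous one when \<open>i\<close> comes last.\<close>

lemma phase_neighbour:
  assumes "i < 3 * m" "c < 5" "d < 5" "(i + d) mod 3 = 1"
  obtains j where "j < 3 * m" "j \<noteq> i" "phase m c j = phase m c i" "phase m d j = phase m d i"
proof (cases "(i + c) mod 3 = 2")
  case False
  have "(i + d) mod 3 \<noteq> 2" using assms(4) by simp
  moreover have "Suc i mod (3 * m) < 3 * m" "Suc i mod (3 * m) \<noteq> i"
    using assms(1) by (auto simp: mod_Suc) presburger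
  ultimately show ?thesis
    using that phase_Suc_mod[OF assms(1)] False by blast
next
  case True
  define j where "j = (if i = 0 then 3 * m - 1 else i - 1)"
  have j: "j < 3 * m" "j \<noteq> i" "Suc j mod (3 * m) = i"
    using assms(1) by (auto simp: j_def)
  have "(j + c) mod 3 \<noteq> 2" "(j + d) mod 3 \<noteq> 2"
  proof -
    have "Suc j mod 3 = i mod 3"
      using j(3) by (metis mod_mod_cancel dvd_triv_left)
    then have "Suc (j + e) mod 3 = (i + e) mod 3" for e
      by (metis add_Suc mod_add_left_eq)
    then show "(j + c) mod 3 \<noteq> 2" "(j + d) mod 3 \<noteq> 2"
      using True assms(4) by (metis mod_Suc numeral_2_eq_2 numeral_3_eq_3 zero_neq_one zero_neq_numeral)+
  qed
  then show ?thesis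
    using that[of j] phase_Suc_mod[OF j(1)] j by metis
qed

section \<open>Split cliques and edge-connectivity\<close>

lemma splits_iff: "splits X B \<longleftrightarrow> (\<exists>x\<in>B. \<exists>y\<in>B. x \<in> X \<and> y \<notin> X)"
  by (auto simp: splits_def)

lemma tri_clique: "c < 5 \<Longrightarrow> i < 3 * m \<Longrightarrow> tri m c (phase m c i) \<in> cliques m"
  by (auto simp: cliques_def phase_def less_mult_imp_div_less mult.commute)

lemma row_clique: "i < 3 * m \<Longrightarrow> row i \<in> cliques m"
  by (simp add: cliques_def)

lemma clique_cases:
  assumes "B \<in> cliques m"
  obtains i where "i < 3 * m" "B = row i"
    | c q where "c < 5" "q < m" "B = tri m c q"
  using assms by (auto simp: cliques_def)

text \<open>If only row \<open>i\<close> were split, membership in \<open>X\<close> would be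
  constant along a detour: from column \<open>c\<close> of row \<open>i\<close> by a triangle to a
  row \<open>j\<close>, along row \<open>j\<close> to column \<open>d\<close>, and back by a
  triangle to row \<open>i\<close>. Hence row \<open>i\<close> would not be split either.\<close>

lemma second_split_clique:
  assumes "i < 3 * m" "splits X (row i)"
  obtains B where "B \<in> cliques m" "B \<noteq> row i" "splits X B"
proof (rule ccontr)
  assume "\<not> thesis"
  then have "\<not> splits X B" if "B \<in> cliques m" "B \<noteq> row i" for B
    using that \<open>\<And>B. \<lbrakk>B \<in> cliques m; B \<noteq> row i; splits X B\<rbrakk> \<Longrightarrow> thesis\<close> by blast
  then have unsplit: "x \<in> X \<longleftrightarrow> y \<in> X"
    if "B \<in> cliques m" "B \<noteq> row i" "x \<in> B" "y \<in> B" for B x y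
    using that by (meson splits_iff)
  have tri: "5 * j + c \<in> X \<longleftrightarrow> 5 * i + c \<in> X"
    if "c < 5" "j < 3 * m" "phase m c j = phase m c i" for j c
  proof (rule unsplit)
    show "tri m c (phase m c i) \<in> cliques m" using that assms tri_clique by blast
    have "card (tri m c (phase m c i)) = 3"
      using assms by (intro card_tri) (simp add: phase_def less_mult_imp_div_less mult.commute)
    moreover have "card (row i) \<noteq> 3" by simp
    ultimately show "tri m c (phase m c i) \<noteq> row i" by metis
  qed (use that assms in \<open>simp_all add: mem_tri_iff\<close>)
  have "\<exists>d<3. (i + d) mod 3 = 1"
    \<comment> \<open>The witness works because \<open>i + (2 * i + 1) = 3 * i + 1\<close>.\<close>
    by (rule exI[of _ "(2 * i + 1) mod 3"]) presburger
  then obtain d where "d < 3" and d1: "(i + d) mod 3 = 1" by blast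
  then have d: "d < 5" "(i + d) mod 3 = 1" by simp_all
  have "5 * i + c \<in> X \<longleftrightarrow> 5 * i + d \<in> X" if c: "c < 5" for c
  proof -
    obtain j where j: "j < 3 * m" "j \<noteq> i" "phase m c j = phase m c i" "phase m d j = phase m d i"
      using phase_neighbour assms(1) c d by metis
    have "row j \<noteq> row i" using row_Int_row[OF j(2)] mem_row[OF c] by blast
    then have "5 * j + c \<in> X \<longleftrightarrow> 5 * j + d \<in> X"
      using unsplit row_clique j(1) mem_row c d(1) by metis
    then show ?thesis using tri[OF c j(1,3)] tri[OF d(1) j(1,4)] by simp
  qed
  then show False using assms(2) by (auto simp: splits_iff row_def)
qed

lemma clique_card:
  assumes "B \<in> cliques m"
  shows "3 \<le> card B"
  using assms by (auto elim!: clique_cases simp: card_tri)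

text \<open>A discrete intermediate value argument, with \<open>a\<close> and \<open>b\<close> in
  either order; it finds two consecutive rows on opposite sides of a cut.\<close>

lemma switch_exists:
  fixes k :: nat
  assumes "a < k" "b < k" "P a" "\<not> P b"
  shows "\<exists>i. Suc i < k \<and> P i \<noteq> P (Suc i)"
proof (rule ccontr)
  assume "\<nexists>i. Suc i < k \<and> P i \<noteq> P (Suc i)"
  then have step: "P i = P (Suc i)" if "Suc i < k" for i using that by blast
  have "P i = P 0" if "i < k" for i using that by (induction i) (auto simp: step[symmetric])
  then show False using assms by blast
qed

lemma braid_6_edge_connected: "k_edge_connected 6 (braid m)"
  unfolding k_edge_connected_def
proof (intro allI impI)
  fix X assume X: "X \<noteq> {} \<and> X \<subset> uverts (braid m)"
  note cut = cut_ge_sum_split_cliques[of "{..<15 * m}" "cliques m" _ X,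
      OF finite_lessThan clique_subset, folded braid_def]
  show "6 \<le> card {e \<in> uedges (braid m). card (e \<inter> X) = 1}"
  proof (cases "\<exists>i<3 * m. splits X (row i)")
    case True
    then obtain i where i: "i < 3 * m" "splits X (row i)" by blast
    then obtain B where B: "B \<in> cliques m" "B \<noteq> row i" "splits X B"
      by (rule second_split_clique)
    have meet: "x = y" if "x \<in> row i \<inter> B" "y \<in> row i \<inter> B" for x y
      using B(1)
    proof (cases rule: clique_cases)
      case (1 j)
      then show ?thesis using B(2) that row_Int_row[of i j] by auto
    next
      case (2 c q)
      then show ?thesis using that row_Int_tri by blast
    qed
    have "(\<Sum>B\<in>{row i, B}. card B - 1) \<le> card {e \<in> uedges (braid m). card (e \<inter> X) = 1}"
      using i B meet row_clique by (intro cut) auto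
    \<comment> \<open>The row contributes 4 edges and \<open>B\<close> at least 2.\<close>
    then show ?thesis using B(2) clique_card[OF B(1)] by simp
  next
    case False
    \<comment> \<open>Each row lies on one side of the cut, so its vertex in column 0 represents
      it.\<close>
    then have row: "5 * i + c \<in> X \<longleftrightarrow> 5 * i \<in> X" if "i < 3 * m" "c < 5" for i c
      using that mem_row[of c i] mem_row[of 0 i] by (auto simp: splits_iff)
    obtain u v where uv: "u \<in> X" "u < 15 * m" "v \<notin> X" "v < 15 * m" using X by auto
    obtain a where a: "a < 3 * m" "5 * a \<in> X"
      using uv row by (metis vertex_cases)
    obtain b where b: "b < 3 * m" "5 * b \<notin> X"
      using uv row by (metis vertex_cases)
    obtain i where i: "Suc i < 3 * m" "(5 * i \<in> X) \<noteq> (5 * Suc i \<in> X)"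
      using switch_exists[of a "3 * m" b "\<lambda>i. 5 * i \<in> X"] a b by blast
    \<comment> \<open>The columns in which rows \<open>i\<close> and \<open>Suc i\<close> share a
      triangle.\<close>
    define D where "D = {c. c < 5 \<and> (i + c) mod 3 \<noteq> 2}"
    let ?t = "\<lambda>c. tri m c (phase m c i)"
    have D: "finite D" "\<And>c. c \<in> D \<Longrightarrow> c < 5" by (auto simp: D_def)
    have t: "5 * i + c \<in> ?t c" "5 * Suc i + c \<in> ?t c" if "c \<in> D" for c
      using that phase_Suc_mod[of i m c] i(1) mem_tri_iff[of c c _ m "phase m c i"]
      by (auto simp: D_def simp del: mult_Suc_right)
    have inj: "inj_on ?t D"
      using D(2) t(1) tri_Int_tri by (intro inj_onI) (metis IntI empty_iff)
    have card_t: "card (?t c) = 3" for c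
      using i(1) by (intro card_tri) (simp add: phase_def less_mult_imp_div_less mult.commute)
    have split: "splits X (?t c)" if "c \<in> D" for c
      using t[OF that] i row[OF _ D(2)[OF that], of i] row[OF _ D(2)[OF that], of "Suc i"]
      unfolding splits_iff by (metis Suc_lessD)
    have mod: "(i + c) mod 3 = (i mod 3 + c) mod 3" for c by (simp add: mod_simps)
    consider "i mod 3 = 0" | "i mod 3 = 1" | "i mod 3 = 2" by linarith
    \<comment> \<open>The columns outside \<open>D\<close> form one residue class mod 3, which has
      at most two members among the five columns. So three triangles are split, giving 2 edges
      each.\<close>
    then have "{0, 1, 3} \<subseteq> D \<or> {0, 2, 3} \<subseteq> D \<or> {1, 2, 4} \<subseteq> D"
      by cases (simp_all add: D_def mod)
    then have "3 \<le> card D" by (elim disjE) (drule card_mono[OF D(1)], simp)+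
    then have "6 \<le> (\<Sum>B\<in>?t ` D. card B - 1)"
      by (simp add: sum.reindex[OF inj] card_t)
    also have "\<dots> \<le> card {e \<in> uedges (braid m). card (e \<inter> X) = 1}"
    proof (intro cut)
      show "?t ` D \<subseteq> cliques m" using D(2) i(1) tri_clique by auto
      show "finite (?t ` D)" using D(1) by simp
      show "splits X B" if "B \<in> ?t ` D" for B using that split by auto
      show "x = y" if BC: "B \<in> ?t ` D" "C \<in> ?t ` D" "B \<noteq> C" and x: "x \<in> B \<inter> C"
        and "y \<in> B \<inter> C" for B C x y
      proof -
        obtain c d where "c < 5" "d < 5" "c \<noteq> d" "B = ?t c" "C = ?t d"
          using BC D(2) by blast
        then show ?thesis using x tri_Int_tri by blast
      qed
    qed
    finally show ?thesis .
  qed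
qed

section \<open>Counting the edges of bipartite subgraphs\<close>

lemma sum_cliques_le: "(\<Sum>B\<in>cliques m. (card B)\<^sup>2 div 4) \<le> 28 * m"
proof -
  let ?g = "\<lambda>B. (card B)\<^sup>2 div 4" and ?T = "(\<lambda>(c, q). tri m c q) ` ({..<5} \<times> {..<m})"
  have "sum ?g (cliques m) \<le> sum ?g (row ` {..<3 * m}) + sum ?g ?T"
    unfolding cliques_def by (subst sum.union_inter[symmetric]) auto
  \<comment> \<open>A row weighs \<open>25 div 4 = 6\<close> and a triangle
    \<open>9 div 4 = 2\<close>. The number of cliques of each kind is bounded by the number of
    indices.\<close>
  also have "sum ?g (row ` {..<3 * m}) \<le> of_nat (card (row ` {..<3 * m})) * 6"
    by (intro sum_bounded_above) auto
  also have "\<dots> \<le> 3 * m * 6" using card_image_le[of "{..<3 * m}" row] by simp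
  also have "sum ?g ?T \<le> of_nat (card ?T) * 2"
    by (intro sum_bounded_above) (auto simp: card_tri)
  also have "\<dots> \<le> 5 * m * 2"
    using card_image_le[of "{..<5::nat} \<times> {..<m}" "\<lambda>(c, q). tri m c q"] by simp
  finally show ?thesis by simp
qed

lemma braid_no_bipartite_2T:
  assumes "2 \<le> m"
  shows "\<not> spanning_bipartite_2T_subgraph H (braid m)"
proof
  assume H: "spanning_bipartite_2T_subgraph H (braid m)"
  then have sub: "uedges H \<subseteq> uedges (braid m)" "uverts H = {..<15 * m}"
    and bip: "bipartite_graph H" and "two_T_graph H"
    by (auto simp: spanning_bipartite_2T_subgraph_def spanning_subgraph_def)
  have "finite (cliques m)" by (simp add: cliques_def)
  moreover have "finite B" if "B \<in> cliques m" for B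
    using clique_subset[OF that] by (rule finite_subset) simp
  ultimately have "card (uedges H) \<le> 28 * m"
    using bipartite_subgraph_clique_union_edges[OF _ _ bip sub(1)[unfolded braid_def]] sum_cliques_le
    by (meson le_trans)
  moreover have "30 * m \<le> card (uedges H) + 2"
    using two_T_graph_card_edges[OF \<open>two_T_graph H\<close>] sub(2) by simp
  \<comment> \<open>The bounds give \<open>30 * m \<le> 28 * m + 2\<close>, which fails exactly from
    \<open>m = 2\<close> on.\<close>
  ultimately show False using assms by simp
qed

theorem theorem4p2:
  shows "\<exists>S :: nat ugraph set.
    infinite S \<and>
    pairwise (\<lambda>G H. \<not> graph_iso G H) S \<and>
    (\<forall>G\<in>S. simple_graph G \<and> k_edge_connected 6 G \<and>
       (\<nexists>H. spanning_bipartite_2T_subgraph H G))"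
proof (intro exI conjI)
  \<comment> \<open>The number of vertices is an isomorphism invariant that determines
    \<open>m\<close>.\<close>
  have card: "card (uverts (braid m)) = 15 * m" for m by simp
  have "inj braid" by (rule injI) (metis card mult_left_cancel zero_neq_numeral)
  then show "infinite (braid ` {2..})"
    by (meson finite_imageD inj_on_subset infinite_Ici subset_UNIV)
  show "pairwise (\<lambda>G H. \<not> graph_iso G H) (braid ` {2..})"
  proof (rule pairwiseI)
    fix G H assume "G \<in> braid ` {2..}" "H \<in> braid ` {2..}" "G \<noteq> H"
    then obtain m n where "G = braid m" "H = braid n" "m \<noteq> n" by auto
    then show "\<not> graph_iso G H"
      using card[of m] card[of n] by (auto simp: graph_iso_def dest!: bij_betw_same_card)
  qed
  show "\<forall>G\<in>braid ` {2..}. simple_graph G \<and> k_edge_connected 6 G \<and>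
      (\<nexists>H. spanning_bipartite_2T_subgraph H G)"
    using simple_graph_clique_union[OF finite_lessThan clique_subset] braid_6_edge_connected
      braid_no_bipartite_2T by (auto simp: braid_def)
qed

end
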